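(* Let $l\leq y$ be positive integers, let $a=(a_1,\ldots,a_l)$ be a non-increasing sequence of positive integers and $b=(b_1,\ldots,b_y)$ a non-increasing sequence of nonnegative integers with $a_1+\cdots+a_l=b_1+\cdots+b_y$. Let $M$ be an $l\times y$ modified Ferrers matrix for $a$. If $b$ is dominated by $c(M)$, then there exists an $l\times y$ $0$--$1$ matrix $M'=(m'_{i,j})$ whose row-sum vector is $a$, whose column-sum vector is $b$, and with $m'_{i,l-i+1}=1$ for every $i\in\{1,\dots,l\}$.
   Context: For an $l\times y$ $0$--$1$ matrix $M=(m_{i,j})$ with $y\geq l$, let $r(M)$ be its vector of row sums and $c(M)=(c_1,\dots,c_y)$ its vector of column sums. $M$ is a modified Ferrers matrix for a sequence $a=(a_1,\dots,a_l)$ of positive integers if $r(M)=a$, $m_{i,l-i+1}=1$ for every $i\in\{1,\dots,l\}$, and for all $i,j$: if $m_{i,j}=0$ then $m_{i,t}=0$ for every $t\geq j$ with $t\neq l-i+1$. For sequences $a=(a_1,\dots,a_l)$, $b=(b_1,\dots,b_y)$ with equal sums, $b$ is dominated by $a$ (written $a\unrhd b$) if $\sum_{i=1}^r a_i\geq \sum_{i=1}^r b_i$ for all positive integers $r$, where $a_i=0$ for $i>l$ and $b_i=0$ for $i>y$. *)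

theory Defs
  imports "Jordan_Normal_Form.Matrix"
begin

(* Rows, columns and list positions are numbered from 0, so the entry m_{i,l-i+1} of an l x y
   matrix with 1-based indices is M $$ (i, l - 1 - i) with i < l = dim_row M here. *)

definition zero_one_mat :: "nat mat \<Rightarrow> bool" where
  "zero_one_mat M \<longleftrightarrow> (\<forall>i<dim_row M. \<forall>j<dim_col M. M $$ (i, j) \<in> {0, 1})"

definition row_sums :: "nat mat \<Rightarrow> nat list" where
  "row_sums M = map (\<lambda>i. \<Sum>j<dim_col M. M $$ (i, j)) [0..<dim_row M]"

definition col_sums :: "nat mat \<Rightarrow> nat list" where
  "col_sums M = map (\<lambda>j. \<Sum>i<dim_row M. M $$ (i, j)) [0..<dim_col M]"

definition antidiag_ones :: "nat mat \<Rightarrow> bool" where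
  "antidiag_ones M \<longleftrightarrow> (\<forall>i<dim_row M. M $$ (i, dim_row M - 1 - i) = 1)"

(* Without dim_row M \<le> dim_col M the entries in antidiag_ones could lie outside M. *)
definition modified_Ferrers :: "nat list \<Rightarrow> nat mat \<Rightarrow> bool" where
  "modified_Ferrers a M \<longleftrightarrow>
     dim_row M \<le> dim_col M \<and> zero_one_mat M \<and> row_sums M = a \<and> antidiag_ones M \<and>
     (\<forall>i<dim_row M. \<forall>j<dim_col M. M $$ (i, j) = 0 \<longrightarrow>
        (\<forall>t. j \<le> t \<and> t < dim_col M \<and> t \<noteq> dim_row M - 1 - i \<longrightarrow> M $$ (i, t) = 0))"

(* take r xs is all of xs when r exceeds the length of xs, which is the same as padding with
   zeros; the two sequences may have different lengths. *)
definition dominated_by :: "nat list \<Rightarrow> nat list \<Rightarrow> bool" where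
  "dominated_by b a \<longleftrightarrow>
     sum_list a = sum_list b \<and> (\<forall>r\<ge>1. sum_list (take r a) \<ge> sum_list (take r b))"

end

theory Submission
  imports Defs
begin

text \<open>If \<open>b\<close> is dominated by the column sums \<open>c\<close> of a 0--1 matrix and \<open>b \<noteq> c\<close>, let \<open>j\<close> be the first
  column with \<open>c j < b j\<close> and \<open>k < j\<close> the last one before it with \<open>b k < c k\<close>. Since \<open>b\<close> is
  non-increasing, \<open>c k \<ge> c j + 2\<close>, so at least two rows have a 1 in column \<open>k\<close> and a 0 in column
  \<open>j\<close>. Only one entry of column \<open>k\<close> is prescribed, so in one of these rows the 1 can be
  moved from column \<open>k\<close> to column \<open>j\<close>. Domination survives the move because the prefix sums of
  length \<open>r\<close>, \<open>k < r \<le> j\<close>, of \<open>c\<close> exceed those of \<open>b\<close>, and the total deficit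
  \<open>\<Sum>j. b j - c j\<close> (with truncated subtraction) drops.\<close>

text \<open>Were \<open>p i = k\<close> in every row with a 1 in column \<open>k\<close> and a 0 in
  column \<open>j\<close>, then \<open>M i k\<close> could exceed \<open>M i j\<close> only where
  \<open>p i = k\<close>, and by at most 1. As \<open>p\<close> is injective, this happens in at
  most one row, against the gap of 2.\<close>

lemma movable_one_exists:
  fixes M :: "nat \<Rightarrow> nat \<Rightarrow> nat"
  assumes le1: "\<And>i. i < l \<Longrightarrow> M i k \<le> 1"
    and p: "inj_on p {..<l}"
    and gap: "(\<Sum>i<l. M i j) + 2 \<le> (\<Sum>i<l. M i k)"
  obtains i where "i < l" "M i k = 1" "M i j = 0" "p i \<noteq> k"
proof (rule ccontr)
  assume "\<not> thesis"
  then have no: "\<And>i. i < l \<Longrightarrow> M i k = 1 \<Longrightarrow> M i j = 0 \<Longrightarrow> p i = k"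
    using that by blast
  let ?P = "{i \<in> {..<l}. p i = k}"
  have "card ?P = card (p ` ?P)"
    by (rule card_image[symmetric]) (rule inj_on_subset[OF p], auto)
  also have "\<dots> \<le> card {k}"
    by (rule card_mono) auto
  finally have card: "card ?P \<le> 1" by simp
  have "(\<Sum>i<l. M i k) \<le> (\<Sum>i<l. M i j + (if p i = k then 1 else 0))"
  proof (rule sum_mono)
    fix i assume "i \<in> {..<l}"
    then show "M i k \<le> M i j + (if p i = k then 1 else 0)"
      using no[of i] le1[of i] by (cases "M i k = 1"; cases "M i j = 0") auto
  qed
  also have "\<dots> = (\<Sum>i<l. M i j) + card ?P"
    by (simp add: sum.distrib sum.If_cases Int_def)
  finally show False using card gap by simp
qed

lemma dominated_transfer_columns:
  fixes b c :: "nat \<Rightarrow> nat"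
  assumes b: "\<And>i j. i \<le> j \<Longrightarrow> j < y \<Longrightarrow> b j \<le> b i"
    and dom: "\<And>r. r \<le> y \<Longrightarrow> sum b {..<r} \<le> sum c {..<r}"
    and ex: "\<exists>j<y. c j < b j"
  obtains k j where "k < j" "j < y" "c j < b j" "b k < c k" "c j + 2 \<le> c k"
    "\<And>r. k < r \<Longrightarrow> r \<le> j \<Longrightarrow> sum b {..<r} < sum c {..<r}"
proof -
  define j where "j = (LEAST j. c j < b j)"
  have "j < y" "c j < b j"
    using ex LeastI[of "\<lambda>j. c j < b j"] Least_le[of "\<lambda>j. c j < b j"] le_less_trans
    unfolding j_def by blast+
  have below: "b i \<le> c i" if "i < j" for i
    using not_less_Least[of i "\<lambda>j. c j < b j"] that unfolding j_def by simp
  define K where "K = {k. k < j \<and> b k < c k}"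
  have fin: "finite K" unfolding K_def by simp
  \<comment> \<open>With no surplus before column \<open>j\<close>, the prefix of length
    \<open>Suc j\<close> would violate domination.\<close>
  have "K \<noteq> {}"
  proof
    assume "K = {}"
    then have "c i \<le> b i" if "i < j" for i
      using that unfolding K_def by (metis (mono_tags, lifting) empty_Collect_eq not_less)
    then have "sum c {..<j} \<le> sum b {..<j}"
      by (intro sum_mono) simp
    then have "sum c {..<Suc j} < sum b {..<Suc j}"
      using \<open>c j < b j\<close> by simp
    then show False using dom[of "Suc j"] \<open>j < y\<close> by simp
  qed
  define k where "k = Max K"
  have "k \<in> K" using Max_in[OF fin \<open>K \<noteq> {}\<close>] unfolding k_def .
  then have k: "k < j" "b k < c k" unfolding K_def by auto
  \<comment> \<open>No column before \<open>j\<close> has a deficit, and column \<open>k\<close> has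
    a surplus.\<close>
  have "sum b {..<r} < sum c {..<r}" if "k < r" "r \<le> j" for r
    by (rule sum_strict_mono_ex1) (use that k below in auto)
  \<comment> \<open>This is the chain \<open>c j < b j \<le> b k < c k\<close>.\<close>
  moreover have "c j + 2 \<le> c k"
    using b[of k j] k \<open>j < y\<close> \<open>c j < b j\<close> by simp
  ultimately show thesis
    using that k \<open>j < y\<close> \<open>c j < b j\<close> by blast
qed

text \<open>Matrices are functions here, so that moving a 1 is a function update. Row sums are
  compared with those of \<open>M\<close>, which every move preserves, so the induction hypothesis
  can be applied to the moved matrix.\<close>

lemma col_sums_dominated_realizable:
  fixes M :: "nat \<Rightarrow> nat \<Rightarrow> nat" and b :: "nat \<Rightarrow> nat"
  assumes b: "\<And>i j. i \<le> j \<Longrightarrow> j < y \<Longrightarrow> b j \<le> b i"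
    and p: "inj_on p {..<l}"
    and "\<And>i j. i < l \<Longrightarrow> j < y \<Longrightarrow> M i j \<le> 1"
    and "\<And>i. i < l \<Longrightarrow> M i (p i) = 1"
    and "\<And>r. r \<le> y \<Longrightarrow> sum b {..<r} \<le> (\<Sum>j<r. \<Sum>i<l. M i j)"
    and "sum b {..<y} = (\<Sum>j<y. \<Sum>i<l. M i j)"
  shows "\<exists>N. (\<forall>i<l. \<forall>j<y. N i j \<le> 1) \<and> (\<forall>i<l. N i (p i) = 1) \<and>
           (\<forall>i<l. (\<Sum>j<y. N i j) = (\<Sum>j<y. M i j)) \<and> (\<forall>j<y. (\<Sum>i<l. N i j) = b j)"
  using assms(3-)
proof (induction "\<Sum>j<y. b j - (\<Sum>i<l. M i j)" arbitrary: M rule: less_induct)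
  case (less M)
  define c where "c j = (\<Sum>i<l. M i j)" for j
  note IH = less.hyps and le1 = less.prems(1) and diag = less.prems(2)
  have dom: "sum b {..<r} \<le> sum c {..<r}" if "r \<le> y" for r
    using less.prems(3)[OF that] unfolding c_def .
  have tot: "sum b {..<y} = sum c {..<y}"
    using less.prems(4) unfolding c_def .
  show ?case
  proof (cases "\<exists>j<y. c j < b j")
    case False
    \<comment> \<open>Now \<open>b \<le> c\<close> in every column, and equal totals leave no room
      for a strict inequality.\<close>
    then have "\<forall>j<y. c j = b j"
      using sum_mono_inv[OF tot] by (metis finite_lessThan lessThan_iff not_less)
    then show ?thesis
      using le1 diag unfolding c_def by (intro exI[of _ M]) auto
  next
    case True
    obtain k j where kj: "k < j" "j < y" "c j < b j" "b k < c k" "c j + 2 \<le> c k"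
      and strict: "\<And>r. k < r \<Longrightarrow> r \<le> j \<Longrightarrow> sum b {..<r} < sum c {..<r}"
      using dominated_transfer_columns[OF b dom True] by metis
    obtain h where h: "h < l" "M h k = 1" "M h j = 0" "p h \<noteq> k"
      using movable_one_exists[of l M k p j] le1 p kj unfolding c_def by auto
    define N where "N = M(h := (M h)(k := 0, j := 1))"
    \<comment> \<open>The column sums after the move; nothing is truncated, since
      \<open>c k \<ge> 2\<close>.\<close>
    define d where "d = c(k := c k - 1, j := Suc (c j))"
    have col: "(\<Sum>i<l. N i t) = d t" for t
    proof -
      have split: "(\<Sum>i<l. X i t) = X h t + (\<Sum>i\<in>{..<l} - {h}. X i t)" for X :: "nat \<Rightarrow> nat \<Rightarrow> nat"
        using h(1) by (intro sum.remove) auto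
      have "(\<Sum>i\<in>{..<l} - {h}. N i t) = (\<Sum>i\<in>{..<l} - {h}. M i t)"
        by (intro sum.cong) (auto simp: N_def)
      then show ?thesis
        using split[of N] split[of M] h kj(1) by (auto simp: N_def d_def c_def)
    qed
    have row: "(\<Sum>t<y. N i t) = (\<Sum>t<y. M i t)" for i
    proof (cases "i = h")
      case True
      have split: "(\<Sum>t<y. X t) = X k + (X j + (\<Sum>t\<in>{..<y} - {k} - {j}. X t))" for X :: "nat \<Rightarrow> nat"
        using kj by (subst sum.remove[of _ k], simp, simp, subst sum.remove[of _ j]) auto
      have "(\<Sum>t\<in>{..<y} - {k} - {j}. N h t) = (\<Sum>t\<in>{..<y} - {k} - {j}. M h t)"
        by (intro sum.cong) (auto simp: N_def)
      then show ?thesis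
        using True split[of "N h"] split[of "M h"] h kj(1) by (auto simp: N_def)
    qed (simp add: N_def)
    \<comment> \<open>Only prefixes that contain column \<open>k\<close> but not column
      \<open>j\<close> lose 1, and for exactly these \<open>strict\<close> provides the
      slack.\<close>
    have pre: "sum d {..<r} + (if k < r \<and> r \<le> j then 1 else 0) = sum c {..<r}" for r
      by (induction r) (use kj in \<open>auto simp: d_def\<close>)
    \<comment> \<open>The deficit of column \<open>j\<close> falls by 1, while column
      \<open>k\<close> keeps deficit 0 because \<open>b k \<le> c k - 1\<close>.\<close>
    have "(\<Sum>t<y. b t - d t) < (\<Sum>t<y. b t - c t)"
      by (rule sum_strict_mono_ex1) (use kj in \<open>auto simp: d_def intro!: bexI[of _ j]\<close>)
    moreover have "N i t \<le> 1" if "i < l" "t < y" for i t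
      using le1[OF that] by (auto simp: N_def)
    moreover have "N i (p i) = 1" if "i < l" for i
      using diag[OF that] h by (auto simp: N_def)
    moreover have "sum b {..<r} \<le> sum d {..<r}" if "r \<le> y" for r
      using pre[of r] dom[OF that] strict[of r] by (auto split: if_splits)
    moreover have "sum b {..<y} = sum d {..<y}"
      using pre[of y] tot kj by simp
    ultimately show ?thesis
      using IH[of N] unfolding col row c_def by blast
  qed
qed

lemma sum_list_take_eq_sum_nth:
  "r \<le> length xs \<Longrightarrow> sum_list (take r xs) = (\<Sum>i<r. xs ! i)"
  by (simp add: sum_list_sum_nth atLeast0LessThan min_absorb2)

theorem theorem2:
  fixes l y :: nat and a b :: "nat list" and M :: "nat mat"
  assumes "1 \<le> l" and "l \<le> y"
    and "length a = l" and "sorted_wrt (\<ge>) a" and "\<forall>x\<in>set a. x > 0"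
    and "length b = y" and "sorted_wrt (\<ge>) b"
    and "sum_list a = sum_list b"
    and "M \<in> carrier_mat l y" and "modified_Ferrers a M"
    and "dominated_by b (col_sums M)"
  shows "\<exists>M' \<in> carrier_mat l y. zero_one_mat M' \<and>
           row_sums M' = a \<and> col_sums M' = b \<and> antidiag_ones M'"
proof -
  have dim: "dim_row M = l" "dim_col M = y" using assms(9) by auto
  have M: "zero_one_mat M" "row_sums M = a" "antidiag_ones M"
    using assms(10) unfolding modified_Ferrers_def by auto
  have len: "length (col_sums M) = y" by (simp add: col_sums_def dim)
  have take_c: "sum_list (take r (col_sums M)) = (\<Sum>j<r. \<Sum>i<l. M $$ (i, j))" if "r \<le> y" for r
    using that len by (subst sum_list_take_eq_sum_nth) (auto simp: col_sums_def dim intro!: sum.cong)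
  have take_b: "sum_list (take r b) = (\<Sum>j<r. b ! j)" if "r \<le> y" for r
    using that assms(6) by (subst sum_list_take_eq_sum_nth) auto
  have "\<exists>N. (\<forall>i<l. \<forall>j<y. N i j \<le> 1) \<and> (\<forall>i<l. N i (l - 1 - i) = 1) \<and>
           (\<forall>i<l. (\<Sum>j<y. N i j) = (\<Sum>j<y. M $$ (i, j))) \<and> (\<forall>j<y. (\<Sum>i<l. N i j) = b ! j)"
  proof (rule col_sums_dominated_realizable)
    show "b ! j \<le> b ! i" if "i \<le> j" "j < y" for i j
      using sorted_wrt_nth_less[OF assms(7), of i j] that assms(6) by (cases "i = j") auto
    show "inj_on (\<lambda>i. l - 1 - i) {..<l}" by (auto simp: inj_on_def)
    show "M $$ (i, j) \<le> 1" if "i < l" "j < y" for i j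
      using M(1) that unfolding zero_one_mat_def dim by fastforce
    show "M $$ (i, l - 1 - i) = 1" if "i < l" for i
      using M(3) that unfolding antidiag_ones_def dim by simp
    show "(\<Sum>j<r. b ! j) \<le> (\<Sum>j<r. \<Sum>i<l. M $$ (i, j))" if "r \<le> y" for r
    proof -
      \<comment> \<open>Domination speaks of \<open>r \<ge> 1\<close>; the empty prefix is settled
        separately.\<close>
      have "sum_list (take r b) \<le> sum_list (take r (col_sums M))"
        using assms(11) unfolding dominated_by_def by (cases "r = 0") auto
      then show ?thesis using take_b[OF that] take_c[OF that] by metis
    qed
    show "(\<Sum>j<y. b ! j) = (\<Sum>j<y. \<Sum>i<l. M $$ (i, j))"
      using assms(11) take_b[of y] take_c[of y] len assms(6) unfolding dominated_by_def by simp
  qed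
  then obtain N where N: "\<forall>i<l. \<forall>j<y. N i j \<le> 1" "\<forall>i<l. N i (l - 1 - i) = 1"
      "\<forall>i<l. (\<Sum>j<y. N i j) = (\<Sum>j<y. M $$ (i, j))" "\<forall>j<y. (\<Sum>i<l. N i j) = b ! j"
    by blast
  let ?N = "mat l y (\<lambda>(i, j). N i j)"
  have "zero_one_mat ?N"
    using N(1) by (auto simp: zero_one_mat_def le_Suc_eq)
  moreover have "row_sums ?N = row_sums M"
    using N(3) by (simp add: row_sums_def dim)
  moreover have "col_sums ?N = b"
    by (rule nth_equalityI) (use N(4) assms(6) in \<open>auto simp: col_sums_def\<close>)
  \<comment> \<open>By \<open>l \<le> y\<close> the column \<open>l - 1 - i\<close> lies inside the
    matrix.\<close>
  moreover have "antidiag_ones ?N"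
    using N(2) assms(2) by (auto simp: antidiag_ones_def)
  ultimately show ?thesis using M(2) by (intro bexI[of _ ?N]) auto
qed

end
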